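(* Let $S_1\ge \|f'\|_{C[-1,1]}=2$, $S_2\ge 0$, and $K_{\mathcal M}:=\max_{\xi\in[-1,1]}\mathcal M(\xi)$. Let $\{\phi^n\}_{n=0}^N\subset\mathbb V_h$ be a solution of the DsCN scheme described in the context, started from $\phi^0=\phi_{\mathrm{init}}$ on $\Omega_h$. (i) If $S_2=0$ and the time step sizes satisfy $$\tau_{n+1}\le \frac{2}{S_1K_{\mathcal M}+2dK_{\mathcal M}\,\varepsilon^2/h^2}\qquad (1\le n\le N-1),$$ then the scheme preserves the discrete maximum bound principle: $\|\phi_{\mathrm{init}}\|_\infty\le1$ implies $\|\phi^{n}\|_\infty\le1$ for all $0\le n\le N$. (ii) If $$S_2\ge\left(\frac{S_1K_{\mathcal M}}{4}+\frac{d\,\varepsilon^2K_{\mathcal M}}{2h^2}\right)^2,$$ then the scheme preserves the discrete maximum bound principle unconditionally: with no restriction on the time step sizes, $\|\phi_{\mathrm{init}}\|_\infty\le1$ implies $\|\phi^{n}\|_\infty\le1$ for all $0\le n\le N$.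
   Context: The scheme discretizes the Allen--Cahn equation $\phi_t=-\mathcal M(\phi)\mu$, $\mu=-\varepsilon^2\Delta\phi-f(\phi)$ on $\Omega=[0,L]^d$, $d\in\{1,2,3\}$, with periodic boundary conditions and initial datum $\phi_{\mathrm{init}}$. Here $\varepsilon>0$, $F(s)=\frac14(1-s^2)^2$, $f(s)=-F'(s)=s-s^3$. The mobility $\mathcal M$ is a nonnegative, possibly degenerate (it may vanish) real function, continuous on $[-1,1]$ (so that the maximum $K_{\mathcal M}$ exists); only its values on $[-1,1]$ matter. If $K_{\mathcal M}=0$ the bound in (i) is read as no restriction. Spatial grid: $M$ is a positive integer, $h=L/M$, $\Omega_h=\{\mathbf x_{\mathbf i}=h\mathbf i:\mathbf i\in\{1,\dots,M\}^d\}$. $\mathbb V_h$ is the set of real-valued grid functions $v=\{v_{\mathbf i}\}$ that are $M$-periodic in each index. $\|v\|_\infty=\max_{\mathbf x_{\mathbf i}\in\Omega_h}|v_{\mathbf i}|$. $\Delta_h$ is the standard second-order central difference Laplacian with periodic indices: $(\Delta_h v)_{\mathbf i}=h^{-2}\sum_{k=1}^d (v_{\mathbf i+\mathbf e_k}-2v_{\mathbf i}+v_{\mathbf i-\mathbf e_k})$, $\mathbf e_k$ being the $k$-th coordinate vector. Time grid: $0=t_0<t_1<\dots<t_N=T$, $\tau_k=t_k-t_{k-1}$ (variable step sizes), $r_{k+1}=\tau_{k+1}/\tau_k$. DsCN scheme (all products, compositions, max/min pointwise on the grid). Step 1 ($n=0$): $\phi^1$ is determined by $$\frac{\phi^{1}-\phi^0}{\tau_{1}}=-\mathcal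 M(\phi^0)\mu^{1},\qquad \mu^{1}=-\varepsilon^2\Delta_h\phi^{1}-f(\phi^0)+S_1(\phi^{1}-\phi^0).$$ Step 2 ($1\le n\le N-1$): with $\bar\phi^{n+\frac12}=\frac12(\phi^{n+1}+\phi^n)$, $$\hat\phi^{n+\frac12}=\min\{\max\{\phi^{*,n},-1\},1\},\qquad \phi^{*,n}=\Big(1+\frac{r_{n+1}}2\Big)\phi^n-\frac{r_{n+1}}2\phi^{n-1},$$ $$\frac{\phi^{n+1}-\phi^n}{\tau_{n+1}}=-\mathcal M(\hat\phi^{n+\frac12})\,\mu^{n+\frac12}-S_2\tau_{n+1}(\phi^{n+1}-\phi^n),$$ $$\mu^{n+\frac12}=-\varepsilon^2\Delta_h\bar\phi^{n+\frac12}-f(\hat\phi^{n+\frac12})+S_1\big(\bar\phi^{n+\frac12}-\hat\phi^{n+\frac12}\big).$$ *)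

theory Defs
  imports "HOL-Analysis.Analysis"
begin

definition F_pot :: "real \<Rightarrow> real" where
  "F_pot s = (1 - s\<^sup>2)\<^sup>2 / 4"

definition f_AC :: "real \<Rightarrow> real" where
  "f_AC s = s - s ^ 3"

lemma F_pot_deriv: "(F_pot has_real_derivative - f_AC s) (at s)"
  unfolding F_pot_def f_AC_def
  by (auto intro!: derivative_eq_intros simp: field_simps power2_eq_square power3_eq_cube)

lemma f_AC_deriv: "(f_AC has_real_derivative 1 - 3 * s\<^sup>2) (at s)"
  unfolding f_AC_def
  by (auto intro!: derivative_eq_intros)

definition C_norm :: "(real \<Rightarrow> real) \<Rightarrow> real" where
  "C_norm g = (SUP s\<in>{-1..1}. \<bar>g s\<bar>)"

lemma C_norm_deriv_f_AC: "C_norm (deriv f_AC) = 2"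
proof -
  have d: "deriv f_AC s = 1 - 3 * s\<^sup>2" for s
    by (rule DERIV_imp_deriv[OF f_AC_deriv])
  have "(SUP s\<in>{-1..1::real}. \<bar>1 - 3 * s\<^sup>2\<bar>) = 2"
  proof (rule cSup_eq_maximum)
    show "2 \<in> (\<lambda>s. \<bar>1 - 3 * s\<^sup>2\<bar>) ` {-1..1::real}"
      by (rule image_eqI[of _ _ 1]) simp_all
  next
    fix y assume "y \<in> (\<lambda>s. \<bar>1 - 3 * s\<^sup>2\<bar>) ` {-1..1::real}"
    then obtain s :: real where s: "- 1 \<le> s" "s \<le> 1" "y = \<bar>1 - 3 * s\<^sup>2\<bar>" by auto
    have "\<bar>s\<bar> \<le> 1" using s by linarith
    then have "s\<^sup>2 \<le> 1" by (simp only: abs_square_le_1)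
    moreover have "0 \<le> s\<^sup>2" by simp
    ultimately show "y \<le> 2" unfolding s(3) by linarith
  qed
  then show ?thesis by (simp add: C_norm_def d)
qed

text \<open>For \<open>Mob\<close> continuous on \<open>[-1,1]\<close> the supremum is a maximum.\<close>

definition K_mob :: "(real \<Rightarrow> real) \<Rightarrow> real" where
  "K_mob Mob = (SUP \<xi>\<in>{-1..1}. Mob \<xi>)"

lemma K_mob_max:
  assumes "continuous_on {-1..1} Mob"
  shows "\<exists>\<xi>\<in>{-1..1}. K_mob Mob = Mob \<xi>"
    and "\<And>\<xi>. \<xi> \<in> {-1..1} \<Longrightarrow> Mob \<xi> \<le> K_mob Mob"
proof -
  have "\<exists>x\<in>{-1..1}. \<forall>y\<in>{-1..1}. Mob y \<le> Mob x"
    by (rule continuous_attains_sup[OF _ _ assms]) simp_all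
  then obtain x where x: "x \<in> {-1..1}" "\<And>y. y \<in> {-1..1} \<Longrightarrow> Mob y \<le> Mob x"
    by blast
  have "K_mob Mob = Mob x"
    unfolding K_mob_def by (rule cSup_eq_maximum) (use x in auto)
  with x show "\<exists>\<xi>\<in>{-1..1}. K_mob Mob = Mob \<xi>"
    and "\<And>\<xi>. \<xi> \<in> {-1..1} \<Longrightarrow> Mob \<xi> \<le> K_mob Mob" by auto
qed

text \<open>
  Grid functions are functions of a multi-index in \<open>int ^ 'd\<close>, so that the space dimension
  is \<open>CARD('d)\<close>; \<open>axis k 1\<close> is the \<open>k\<close>-th coordinate vector.
\<close>

definition grid_idx :: "nat \<Rightarrow> (int ^ 'd) set" where
  "grid_idx M = {i. \<forall>k. 1 \<le> i $ k \<and> i $ k \<le> int M}"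

definition grid_point :: "real \<Rightarrow> int ^ 'd \<Rightarrow> real ^ 'd" where
  "grid_point h i = (\<chi> k. h * real_of_int (i $ k))"

definition V_h :: "nat \<Rightarrow> (int ^ 'd \<Rightarrow> real) set" where
  "V_h M = {v. \<forall>i k. v (i + axis k (int M)) = v i}"

definition sup_norm_h :: "nat \<Rightarrow> (int ^ 'd \<Rightarrow> real) \<Rightarrow> real" where
  "sup_norm_h M v = Max ((\<lambda>i. \<bar>v i\<bar>) ` grid_idx M)"

lemma finite_grid_idx: "finite (grid_idx M :: (int ^ 'd) set)"
proof -
  have "grid_idx M \<subseteq> vec_lambda ` (Pi\<^sub>E (UNIV :: 'd set) (\<lambda>_. {1..int M}))"
  proof
    fix i :: "int ^ 'd" assume "i \<in> grid_idx M"
    then have "vec_nth i \<in> Pi\<^sub>E UNIV (\<lambda>_. {1..int M})"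
      by (simp add: grid_idx_def PiE_iff)
    then have "vec_lambda (vec_nth i) \<in> vec_lambda ` (Pi\<^sub>E (UNIV :: 'd set) (\<lambda>_. {1..int M}))"
      by (rule imageI)
    then show "i \<in> vec_lambda ` (Pi\<^sub>E (UNIV :: 'd set) (\<lambda>_. {1..int M}))"
      by (simp add: vec_nth_inverse)
  qed
  then show ?thesis
    by (rule finite_subset) (intro finite_imageI finite_PiE; simp)
qed

lemma grid_idx_nonempty: "M \<ge> 1 \<Longrightarrow> (grid_idx M :: (int ^ 'd) set) \<noteq> {}"
  by (auto simp: grid_idx_def intro!: exI[of _ "\<chi> k. 1"])

definition laplace_h :: "real \<Rightarrow> (int ^ 'd \<Rightarrow> real) \<Rightarrow> int ^ 'd \<Rightarrow> real" where
  "laplace_h h v i =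
     (\<Sum>k\<in>UNIV. v (i + axis k 1) - 2 * v i + v (i - axis k 1)) / h\<^sup>2"

definition time_grid :: "real \<Rightarrow> nat \<Rightarrow> (nat \<Rightarrow> real) \<Rightarrow> bool" where
  "time_grid T N t \<longleftrightarrow> 1 \<le> N \<and> t 0 = 0 \<and> (\<forall>k<N. t k < t (Suc k)) \<and> t N = T"

text \<open>\<open>tau\<close> is meant for indices \<open>k \<ge> 1\<close> and \<open>ratio\<close> for \<open>k \<ge> 2\<close>.\<close>

definition tau :: "(nat \<Rightarrow> real) \<Rightarrow> nat \<Rightarrow> real" where
  "tau t k = t k - t (k - 1)"

definition ratio :: "(nat \<Rightarrow> real) \<Rightarrow> nat \<Rightarrow> real" where
  "ratio t k = tau t k / tau t (k - 1)"

definition mu_first ::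
  "real \<Rightarrow> real \<Rightarrow> real \<Rightarrow> (int ^ 'd \<Rightarrow> real) \<Rightarrow> (int ^ 'd \<Rightarrow> real) \<Rightarrow> int ^ 'd \<Rightarrow> real" where
  "mu_first \<epsilon> h S1 \<phi>0 \<phi>1 i =
     - \<epsilon>\<^sup>2 * laplace_h h \<phi>1 i - f_AC (\<phi>0 i) + S1 * (\<phi>1 i - \<phi>0 i)"

definition first_step ::
  "nat \<Rightarrow> real \<Rightarrow> real \<Rightarrow> (real \<Rightarrow> real) \<Rightarrow> real \<Rightarrow> (nat \<Rightarrow> real)
    \<Rightarrow> (nat \<Rightarrow> int ^ 'd \<Rightarrow> real) \<Rightarrow> bool" where
  "first_step M \<epsilon> h Mob S1 t \<phi> \<longleftrightarrow>
     (\<forall>i\<in>grid_idx M.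
        (\<phi> 1 i - \<phi> 0 i) / tau t 1 = - Mob (\<phi> 0 i) * mu_first \<epsilon> h S1 (\<phi> 0) (\<phi> 1) i)"

definition phi_bar :: "(nat \<Rightarrow> int ^ 'd \<Rightarrow> real) \<Rightarrow> nat \<Rightarrow> int ^ 'd \<Rightarrow> real" where
  "phi_bar \<phi> n i = (\<phi> (n + 1) i + \<phi> n i) / 2"

definition phi_star ::
  "(nat \<Rightarrow> real) \<Rightarrow> (nat \<Rightarrow> int ^ 'd \<Rightarrow> real) \<Rightarrow> nat \<Rightarrow> int ^ 'd \<Rightarrow> real" where
  "phi_star t \<phi> n i =
     (1 + ratio t (n + 1) / 2) * \<phi> n i - ratio t (n + 1) / 2 * \<phi> (n - 1) i"

definition phi_hat ::
  "(nat \<Rightarrow> real) \<Rightarrow> (nat \<Rightarrow> int ^ 'd \<Rightarrow> real) \<Rightarrow> nat \<Rightarrow> int ^ 'd \<Rightarrow> real" where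
  "phi_hat t \<phi> n i = min (max (phi_star t \<phi> n i) (- 1)) 1"

definition mu_half ::
  "real \<Rightarrow> real \<Rightarrow> real \<Rightarrow> (nat \<Rightarrow> real) \<Rightarrow> (nat \<Rightarrow> int ^ 'd \<Rightarrow> real)
    \<Rightarrow> nat \<Rightarrow> int ^ 'd \<Rightarrow> real" where
  "mu_half \<epsilon> h S1 t \<phi> n i =
     - \<epsilon>\<^sup>2 * laplace_h h (phi_bar \<phi> n) i - f_AC (phi_hat t \<phi> n i)
       + S1 * (phi_bar \<phi> n i - phi_hat t \<phi> n i)"

definition CN_step ::
  "nat \<Rightarrow> real \<Rightarrow> real \<Rightarrow> (real \<Rightarrow> real) \<Rightarrow> real \<Rightarrow> real \<Rightarrow> (nat \<Rightarrow> real)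
    \<Rightarrow> (nat \<Rightarrow> int ^ 'd \<Rightarrow> real) \<Rightarrow> nat \<Rightarrow> bool" where
  "CN_step M \<epsilon> h Mob S1 S2 t \<phi> n \<longleftrightarrow>
     (\<forall>i\<in>grid_idx M.
        (\<phi> (n + 1) i - \<phi> n i) / tau t (n + 1) =
          - Mob (phi_hat t \<phi> n i) * mu_half \<epsilon> h S1 t \<phi> n i
          - S2 * tau t (n + 1) * (\<phi> (n + 1) i - \<phi> n i))"

definition DsCN_solution ::
  "nat \<Rightarrow> real \<Rightarrow> real \<Rightarrow> (real \<Rightarrow> real) \<Rightarrow> real \<Rightarrow> real \<Rightarrow> nat \<Rightarrow> (nat \<Rightarrow> real)
    \<Rightarrow> (real ^ 'd \<Rightarrow> real) \<Rightarrow> (nat \<Rightarrow> int ^ 'd \<Rightarrow> real) \<Rightarrow> bool" where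
  "DsCN_solution M \<epsilon> h Mob S1 S2 N t \<phi>init \<phi> \<longleftrightarrow>
     (\<forall>n\<le>N. \<phi> n \<in> V_h M) \<and>
     (\<forall>i\<in>grid_idx M. \<phi> 0 i = \<phi>init (grid_point h i)) \<and>
     first_step M \<epsilon> h Mob S1 t \<phi> \<and>
     (\<forall>n. 1 \<le> n \<and> n < N \<longrightarrow> CN_step M \<epsilon> h Mob S1 S2 t \<phi> n)"

end

theory Submission
  imports Defs
begin

text \<open>
  Each step is, at every grid point, an equation \<open>a v - b \<Delta>v = g\<close> for the new level \<open>v\<close> with
  \<open>a > 0\<close>, \<open>b \<ge> 0\<close> varying over the grid, where \<open>g\<close> collects the explicit terms. At a maximum of
  \<open>v\<close> one has \<open>\<Delta>v \<le> 0\<close>, so \<open>\<bar>g\<bar> \<le> a\<close> forces \<open>v \<le> 1\<close>, and symmetrically \<open>v \<ge> -1\<close>. The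
  stabilisation \<open>S1 \<ge> 2\<close> gives \<open>\<bar>f(s) + S1 s\<bar> \<le> S1\<close> on \<open>[-1,1]\<close>; the explicit half of the
  Crank--Nicolson diffusion is controlled as soon as the coefficient of the old value at the
  centre point is nonnegative, that is \<open>\<tau> K (S1/2 + d \<epsilon>\<^sup>2/h\<^sup>2) \<le> 1 + S2 \<tau>\<^sup>2\<close>. Part (i)
  assumes this directly, and in part (ii) it is the inequality \<open>2 x \<le> 1 + x\<^sup>2\<close>.
\<close>

section \<open>Periodicity and the maximum norm\<close>

lemma V_h_shift:
  assumes "v \<in> V_h M"
  shows "v (i + axis k (int M * z)) = v i"
proof (induction z rule: int_induct[where k = 0])
  case base
  show ?case by (simp add: axis_def zero_vec_def[symmetric])
next
  case (step1 z)
  have "i + axis k (int M * (z + 1)) = (i + axis k (int M * z)) + axis k (int M)"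
    by (auto simp: vec_eq_iff axis_def algebra_simps)
  with step1 assms show ?case by (simp only: V_h_def mem_Collect_eq)
next
  case (step2 z)
  have "i + axis k (int M * z) = (i + axis k (int M * (z - 1))) + axis k (int M)"
    by (auto simp: vec_eq_iff axis_def algebra_simps)
  with step2 assms show ?case by (simp only: V_h_def mem_Collect_eq)
qed

text \<open>Periodicity acts along one axis at a time, so the coordinates are reduced modulo
  \<open>M\<close> one by one, by induction over the set \<open>S\<close> of those already
  reduced.\<close>

lemma V_h_grid_representative:
  fixes v :: "int ^ 'd \<Rightarrow> real"
  assumes M: "M \<ge> 1" and v: "v \<in> V_h M"
  shows "\<exists>j\<in>grid_idx M. v i = v j"
proof -
  \<comment> \<open>Subtracting 1 before \<open>mod\<close> and adding it back puts the residues in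
    \<open>1..M\<close>, the range of \<open>grid_idx\<close>, instead of
    \<open>0..M-1\<close>.\<close>
  define red where "red x = (x - 1) mod int M + 1" for x
  have shift: "red x = x + int M * (- ((x - 1) div int M))" for x
    unfolding red_def using mult_div_mod_eq[of "int M" "x - 1"] by linarith
  have partial: "v (\<chi> k. if k \<in> S then red (i $ k) else i $ k) = v i" if "finite S" for S
    using that
  proof induction
    case (insert l S)
    have "(\<chi> k. if k \<in> insert l S then red (i $ k) else i $ k) =
        (\<chi> k. if k \<in> S then red (i $ k) else i $ k)
          + axis l (int M * (- ((i $ l - 1) div int M)))"
      using insert.hyps by (auto simp: vec_eq_iff axis_def shift)
    with insert.IH show ?case by (simp only: V_h_shift[OF v])
  qed simp
  show ?thesis
  proof
    show "v i = v (\<chi> k. red (i $ k))" using partial[of UNIV] by simp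
    show "(\<chi> k. red (i $ k)) \<in> grid_idx M"
      using M by (auto simp: grid_idx_def red_def zle_add1_eq_le intro: zless_imp_add1_zle)
  qed
qed

lemma sup_norm_h_le_iff:
  fixes v :: "int ^ 'd \<Rightarrow> real"
  assumes "M \<ge> 1"
  shows "sup_norm_h M v \<le> c \<longleftrightarrow> (\<forall>i\<in>grid_idx M. \<bar>v i\<bar> \<le> c)"
  unfolding sup_norm_h_def
  using finite_grid_idx[of M] grid_idx_nonempty[OF assms]
  by (subst Max_le_iff) auto

text \<open>The Laplacian at a boundary index reads neighbours outside \<open>grid_idx\<close>; this
  carries norm bounds over to all indices.\<close>

lemma sup_norm_h_le_iff_all:
  assumes "M \<ge> 1" "v \<in> V_h M"
  shows "sup_norm_h M v \<le> c \<longleftrightarrow> (\<forall>i. \<bar>v i\<bar> \<le> c)"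
  unfolding sup_norm_h_le_iff[OF assms(1)]
  by (metis V_h_grid_representative[OF assms])

section \<open>Discrete Laplacian and maximum principle\<close>

lemma laplace_h_uminus: "laplace_h h (\<lambda>i. - v i) i = - laplace_h h v i"
proof -
  have "laplace_h h (\<lambda>i. - v i) i =
      (\<Sum>k\<in>UNIV. - (v (i + axis k 1) - 2 * v i + v (i - axis k 1))) / h\<^sup>2"
    by (simp add: laplace_h_def)
  also have "\<dots> = - laplace_h h v i"
    by (simp only: sum_negf laplace_h_def minus_divide_left)
  finally show ?thesis .
qed

lemma laplace_h_phi_bar:
  "laplace_h h (phi_bar \<phi> n) i = (laplace_h h (\<phi> (n + 1)) i + laplace_h h (\<phi> n) i) / 2"
proof -
  have "laplace_h h (phi_bar \<phi> n) i =
      (\<Sum>k\<in>UNIV. ((\<phi> (n + 1) (i + axis k 1) - 2 * \<phi> (n + 1) i + \<phi> (n + 1) (i - axis k 1))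
        + (\<phi> n (i + axis k 1) - 2 * \<phi> n i + \<phi> n (i - axis k 1))) / 2) / h\<^sup>2"
    unfolding laplace_h_def phi_bar_def
    by (intro arg_cong2[where f = "(/)"] sum.cong refl) (simp add: field_simps)
  also have "\<dots> = (laplace_h h (\<phi> (n + 1)) i + laplace_h h (\<phi> n) i) / 2"
    unfolding laplace_h_def by (simp only: sum_divide_distrib[symmetric] sum.distrib) (simp add: add_divide_distrib)
  finally show ?thesis .
qed

lemma laplace_h_nonpos_at_max:
  assumes "\<And>j. v j \<le> v i"
  shows "laplace_h h v i \<le> 0"
proof -
  have "v (i + axis k 1) - 2 * v i + v (i - axis k 1) \<le> 0" for k
    using assms[of "i + axis k 1"] assms[of "i - axis k 1"] by linarith
  then show ?thesis
    unfolding laplace_h_def by (intro divide_nonpos_nonneg sum_nonpos) auto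
qed

text \<open>The inequality is evaluated at a single maximiser, so \<open>a\<close> and
  \<open>b\<close> may depend on the point. The case \<open>b = 0\<close> must be allowed: it occurs
  where the mobility vanishes.\<close>

lemma maximum_principle_upper:
  fixes v :: "int ^ 'd \<Rightarrow> real"
  assumes M: "M \<ge> 1" and v: "v \<in> V_h M"
    and eq: "\<And>i. i \<in> grid_idx M \<Longrightarrow> \<exists>a>0. \<exists>b\<ge>0. a * v i - b * laplace_h h v i \<le> a"
  shows "v j \<le> 1"
proof -
  have "Max (v ` grid_idx M) \<in> v ` grid_idx M"
    using grid_idx_nonempty[OF M] by (intro Max_in finite_imageI finite_grid_idx) simp
  then obtain i where i: "i \<in> grid_idx M" "Max (v ` grid_idx M) = v i" by (rule imageE) simp
  have max: "v j \<le> v i" for j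
    using V_h_grid_representative[OF M v, of j]
    unfolding i(2)[symmetric] by (auto intro!: Max_ge finite_imageI finite_grid_idx)
  obtain a b where ab: "a > 0" "b \<ge> 0" "a * v i - b * laplace_h h v i \<le> a"
    using eq[OF i(1)] by blast
  have "b * laplace_h h v i \<le> 0"
    using ab(2) laplace_h_nonpos_at_max[of v i h, OF max] by (rule mult_nonneg_nonpos)
  with ab have "a * v i \<le> a * 1" by linarith
  with ab(1) have "v i \<le> 1" by (simp only: mult_le_cancel_left_pos)
  with max[of j] show ?thesis by linarith
qed

lemma maximum_principle:
  fixes v :: "int ^ 'd \<Rightarrow> real"
  assumes M: "M \<ge> 1" and v: "v \<in> V_h M"
    and eq: "\<And>i. i \<in> grid_idx M \<Longrightarrow> \<exists>a>0. \<exists>b\<ge>0. \<bar>a * v i - b * laplace_h h v i\<bar> \<le> a"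
  shows "\<bar>v j\<bar> \<le> 1"
proof -
  have "v j \<le> 1"
    using M v eq by (intro maximum_principle_upper[of M v h]) fastforce+
  moreover have "- v j \<le> 1"
  proof (rule maximum_principle_upper[of M "\<lambda>j. - v j" h, OF M])
    show "(\<lambda>j. - v j) \<in> V_h M" using v by (simp add: V_h_def)
    show "\<exists>a>0. \<exists>b\<ge>0. a * - v i - b * laplace_h h (\<lambda>j. - v j) i \<le> a" if "i \<in> grid_idx M" for i
      using eq[OF that] unfolding laplace_h_uminus by (fastforce simp: abs_le_iff)
  qed
  ultimately show ?thesis by linarith
qed

section \<open>Bounds on the explicit terms\<close>

lemma explicit_diffusion_bound:
  fixes w :: "int ^ 'd \<Rightarrow> real"
  assumes w: "\<And>i. \<bar>w i\<bar> \<le> 1" and b: "b \<ge> 0" and c: "2 * real CARD('d) * b / h\<^sup>2 \<le> c"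
  shows "\<bar>c * w i + b * laplace_h h w i\<bar> \<le> c"
proof -
  let ?D = "real CARD('d)"
  define s where "s = (\<Sum>k\<in>UNIV. w (i + axis k 1) + w (i - axis k 1))"
  have "\<bar>s\<bar> \<le> (\<Sum>k\<in>(UNIV :: 'd set). \<bar>w (i + axis k 1) + w (i - axis k 1)\<bar>)"
    unfolding s_def by (rule sum_abs)
  also have "\<dots> \<le> (\<Sum>k\<in>(UNIV :: 'd set). 2)"
  proof (rule sum_mono)
    show "\<bar>w (i + axis k 1) + w (i - axis k 1)\<bar> \<le> 2" for k
      using w[of "i + axis k 1"] w[of "i - axis k 1"] by linarith
  qed
  finally have s: "\<bar>s\<bar> \<le> 2 * ?D" by simp
  have lap: "laplace_h h w i = (s - 2 * ?D * w i) / h\<^sup>2"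
    unfolding laplace_h_def s_def by (simp add: sum.distrib sum_subtractf algebra_simps)
  define q where "q = b / h\<^sup>2"
  have q: "q \<ge> 0" using b by (simp add: q_def)
  have cq: "2 * ?D * q \<le> c" using c by (simp add: q_def)
  \<comment> \<open>The centre has weight \<open>c - 2 * ?D * q\<close>, nonnegative by
    \<open>cq\<close>, and each of the \<open>2 * ?D\<close> neighbours has weight \<open>q\<close>.
    The weights add up to \<open>c\<close>, which gives the bound.\<close>
  have "c * w i + b * laplace_h h w i = (c - 2 * ?D * q) * w i + q * s"
    unfolding lap q_def by (simp add: field_simps diff_divide_distrib)
  also have "\<bar>\<dots>\<bar> \<le> (c - 2 * ?D * q) * \<bar>w i\<bar> + q * \<bar>s\<bar>"
    using q cq by (intro order.trans[OF abs_triangle_ineq]) (simp add: abs_mult)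
  also have "\<dots> \<le> (c - 2 * ?D * q) * 1 + q * (2 * ?D)"
    using q cq s w[of i] by (intro add_mono mult_left_mono) auto
  finally show ?thesis by (simp add: algebra_simps)
qed

lemma stabilised_f_AC_bound:
  assumes s: "\<bar>s\<bar> \<le> 1" and S1: "S1 \<ge> 2"
  shows "\<bar>f_AC s + S1 * s\<bar> \<le> S1"
proof -
  have s': "-1 \<le> s" "s \<le> 1" using s by auto
  have ss: "s * s \<le> 1" using abs_square_le_1[of s] s by (simp add: power2_eq_square)
  \<comment> \<open>These products are factorisations of \<open>S1 - (f_AC s + S1 * s)\<close> and
    \<open>S1 + (f_AC s + S1 * s)\<close>.\<close>
  have "0 \<le> (1 - s) * (S1 - (s + s * s))"
    using s' ss S1 by (intro mult_nonneg_nonneg) linarith+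
  moreover have "0 \<le> (1 + s) * (S1 + (s - s * s))"
    using s' ss S1 by (intro mult_nonneg_nonneg) linarith+
  ultimately show ?thesis
    unfolding f_AC_def abs_le_iff by (simp add: algebra_simps power3_eq_cube)
qed

section \<open>One time step\<close>

lemma first_step_bound:
  fixes \<phi> :: "nat \<Rightarrow> int ^ 'd \<Rightarrow> real"
  assumes M: "M \<ge> 1" and S1: "S1 \<ge> 2" and tau: "tau t 1 > 0"
    and Mob: "\<And>\<xi>. \<xi> \<in> {-1..1} \<Longrightarrow> Mob \<xi> \<ge> 0"
    and v: "\<phi> 1 \<in> V_h M" and bd: "\<And>i. \<bar>\<phi> 0 i\<bar> \<le> 1"
    and step: "first_step M \<epsilon> h Mob S1 t \<phi>"
  shows "\<bar>\<phi> 1 j\<bar> \<le> 1"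
proof (rule maximum_principle[OF M v])
  fix i :: "int ^ 'd" assume i: "i \<in> grid_idx M"
  define m where "m = tau t 1 * Mob (\<phi> 0 i)"
  have m: "m \<ge> 0" using tau Mob[of "\<phi> 0 i"] bd[of i] by (simp add: m_def abs_le_iff)
  have "(\<phi> 1 i - \<phi> 0 i) / tau t 1 = - Mob (\<phi> 0 i) * mu_first \<epsilon> h S1 (\<phi> 0) (\<phi> 1) i"
    using step i by (simp add: first_step_def)
  then have "\<phi> 1 i - \<phi> 0 i = - m * mu_first \<epsilon> h S1 (\<phi> 0) (\<phi> 1) i"
    using tau by (simp add: m_def field_simps)
  \<comment> \<open>Diffusion is fully implicit here, so the right-hand side contains no neighbour
    values and is bounded by \<open>1 + m * S1\<close> for every step size.\<close>
  then have eq: "(1 + m * S1) * \<phi> 1 i - (m * \<epsilon>\<^sup>2) * laplace_h h (\<phi> 1) i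
      = \<phi> 0 i + m * (f_AC (\<phi> 0 i) + S1 * \<phi> 0 i)"
    unfolding mu_first_def by (simp add: algebra_simps)
  have "\<bar>\<phi> 0 i + m * (f_AC (\<phi> 0 i) + S1 * \<phi> 0 i)\<bar>
      \<le> \<bar>\<phi> 0 i\<bar> + m * \<bar>f_AC (\<phi> 0 i) + S1 * \<phi> 0 i\<bar>"
    using m by (intro order.trans[OF abs_triangle_ineq]) (simp add: abs_mult)
  also have "\<dots> \<le> 1 + m * S1"
    using m bd stabilised_f_AC_bound[OF bd S1] by (intro add_mono mult_left_mono)
  finally show "\<exists>a>0. \<exists>b\<ge>0. \<bar>a * \<phi> 1 i - b * laplace_h h (\<phi> 1) i\<bar> \<le> a"
    using eq m S1
    by (intro exI[of _ "1 + m * S1"] conjI exI[of _ "m * \<epsilon>\<^sup>2"])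
       (auto intro: add_pos_nonneg)
qed

text \<open>\<open>cond\<close> makes the weight of the old centre value nonnegative in the worst
  case, where the mobility equals \<open>K\<close>.\<close>

lemma CN_step_bound:
  fixes \<phi> :: "nat \<Rightarrow> int ^ 'd \<Rightarrow> real"
  assumes M: "M \<ge> 1" and S1: "S1 \<ge> 2" and S2: "S2 \<ge> 0"
    and tau: "tau t (n + 1) > 0"
    and Mob: "\<And>\<xi>. \<xi> \<in> {-1..1} \<Longrightarrow> 0 \<le> Mob \<xi> \<and> Mob \<xi> \<le> K"
    and cond: "tau t (n + 1) * K * (S1 / 2 + real CARD('d) * \<epsilon>\<^sup>2 / h\<^sup>2)
                 \<le> 1 + S2 * (tau t (n + 1))\<^sup>2"
    and v: "\<phi> (n + 1) \<in> V_h M" and bd: "\<And>i. \<bar>\<phi> n i\<bar> \<le> 1"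
    and step: "CN_step M \<epsilon> h Mob S1 S2 t \<phi> n"
  shows "\<bar>\<phi> (n + 1) j\<bar> \<le> 1"
proof (rule maximum_principle[OF M v])
  fix i :: "int ^ 'd" assume i: "i \<in> grid_idx M"
  let ?\<tau> = "tau t (n + 1)" and ?s = "phi_hat t \<phi> n i"
  let ?P = "S1 / 2 + real CARD('d) * \<epsilon>\<^sup>2 / h\<^sup>2"
  define m where "m = ?\<tau> * Mob ?s"
  \<comment> \<open>\<open>A\<close> merges the time difference with the \<open>S2\<close> term, so
    that the step reads \<open>A\<close> times the increment equals \<open>-m\<close> times the
    chemical potential.\<close>
  define A where "A = 1 + S2 * ?\<tau>\<^sup>2"
  \<comment> \<open>The cut-off ensures this whatever the extrapolated value is.\<close>
  have s: "\<bar>?s\<bar> \<le> 1" by (auto simp: phi_hat_def abs_le_iff)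
  then have Ms: "0 \<le> Mob ?s" "Mob ?s \<le> K" using Mob[of ?s] by (auto simp: abs_le_iff)
  then have m: "0 \<le> m" "m \<le> ?\<tau> * K" using tau by (auto simp: m_def)
  have A: "A > 0" using S2 by (auto simp: A_def intro: add_pos_nonneg)
  have "m * ?P \<le> ?\<tau> * K * ?P" using m(2) S1 by (intro mult_right_mono) auto
  with cond have mA: "m * ?P \<le> A" by (simp add: A_def)
  have "(\<phi> (n + 1) i - \<phi> n i) / ?\<tau> =
      - Mob ?s * mu_half \<epsilon> h S1 t \<phi> n i - S2 * ?\<tau> * (\<phi> (n + 1) i - \<phi> n i)"
    using step i by (simp only: CN_step_def)
  then have "\<phi> (n + 1) i - \<phi> n i =
      ?\<tau> * (- Mob ?s * mu_half \<epsilon> h S1 t \<phi> n i - S2 * ?\<tau> * (\<phi> (n + 1) i - \<phi> n i))"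
    using tau by (simp only: divide_eq_eq) (simp add: mult.commute)
  then have "A * (\<phi> (n + 1) i - \<phi> n i) = - m * mu_half \<epsilon> h S1 t \<phi> n i"
    by (simp add: A_def m_def algebra_simps power2_eq_square)
  then have eq: "(A + m * S1 / 2) * \<phi> (n + 1) i - (m * \<epsilon>\<^sup>2 / 2) * laplace_h h (\<phi> (n + 1)) i
      = ((A - m * S1 / 2) * \<phi> n i + (m * \<epsilon>\<^sup>2 / 2) * laplace_h h (\<phi> n) i)
        + m * (f_AC ?s + S1 * ?s)"
    unfolding mu_half_def laplace_h_phi_bar phi_bar_def
    by (simp add: algebra_simps add_divide_distrib)
  \<comment> \<open>With \<open>c = A - m * S1 / 2\<close> and
    \<open>b = m * \<epsilon>\<^sup>2 / 2\<close>, the condition on \<open>c\<close> is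
    \<open>mA\<close> rearranged. Adding the reaction bound \<open>m * S1\<close> yields exactly the
    implicit coefficient \<open>A + m * S1 / 2\<close>.\<close>
  have "\<bar>(A - m * S1 / 2) * \<phi> n i + (m * \<epsilon>\<^sup>2 / 2) * laplace_h h (\<phi> n) i\<bar> \<le> A - m * S1 / 2"
    using bd m(1) mA by (intro explicit_diffusion_bound) (auto simp: algebra_simps)
  moreover have "\<bar>m * (f_AC ?s + S1 * ?s)\<bar> \<le> m * S1"
    using m(1) stabilised_f_AC_bound[OF s S1] by (simp add: abs_mult mult_left_mono)
  ultimately have "\<bar>(A + m * S1 / 2) * \<phi> (n + 1) i
      - (m * \<epsilon>\<^sup>2 / 2) * laplace_h h (\<phi> (n + 1)) i\<bar> \<le> A + m * S1 / 2"
    unfolding eq by linarith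
  then show "\<exists>a>0. \<exists>b\<ge>0. \<bar>a * \<phi> (n + 1) i - b * laplace_h h (\<phi> (n + 1)) i\<bar> \<le> a"
    using A m(1) S1
    by (intro exI[of _ "A + m * S1 / 2"] conjI exI[of _ "m * \<epsilon>\<^sup>2 / 2"])
       (auto intro: add_pos_nonneg)
qed

section \<open>Induction over the time levels and the two step conditions\<close>

lemma DsCN_maximum_bound:
  fixes \<phi> :: "nat \<Rightarrow> int ^ 'd \<Rightarrow> real"
  assumes M: "M \<ge> 1" and S1: "S1 \<ge> 2" and S2: "S2 \<ge> 0" and grid: "time_grid T N t"
    and Mob: "\<And>\<xi>. \<xi> \<in> {-1..1} \<Longrightarrow> 0 \<le> Mob \<xi> \<and> Mob \<xi> \<le> K"
    and sol: "DsCN_solution M \<epsilon> h Mob S1 S2 N t \<phi>init \<phi>"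
    and cond: "\<And>n. 1 \<le> n \<Longrightarrow> n < N \<Longrightarrow>
        tau t (n + 1) * K * (S1 / 2 + real CARD('d) * \<epsilon>\<^sup>2 / h\<^sup>2) \<le> 1 + S2 * (tau t (n + 1))\<^sup>2"
    and init: "sup_norm_h M (\<lambda>i. \<phi>init (grid_point h i)) \<le> 1"
    and n: "n \<le> N"
  shows "sup_norm_h M (\<phi> n) \<le> 1"
proof -
  have V: "\<phi> n \<in> V_h M" if "n \<le> N" for n using sol that by (simp add: DsCN_solution_def)
  have tau: "tau t (n + 1) > 0" if "n < N" for n
    using grid that by (simp add: time_grid_def tau_def)
  \<comment> \<open>The induction runs on the pointwise bound at all indices, the form that the
    one-step lemmas take.\<close>
  have "\<forall>i. \<bar>\<phi> n i\<bar> \<le> 1"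
    using n
  proof (induction n)
    case 0
    have "\<forall>i\<in>grid_idx M. \<phi> 0 i = \<phi>init (grid_point h i)"
      using sol by (simp add: DsCN_solution_def)
    with init have "sup_norm_h M (\<phi> 0) \<le> 1" by (simp add: sup_norm_h_le_iff[OF M])
    then show ?case using sup_norm_h_le_iff_all[OF M V[of 0, simplified]] by simp
  next
    case (Suc n)
    then have bd: "\<bar>\<phi> n i\<bar> \<le> 1" for i by simp
    have nN: "n < N" using Suc.prems by simp
    show ?case
    proof (cases "n = 0")
      case True
      have "first_step M \<epsilon> h Mob S1 t \<phi>" using sol by (simp add: DsCN_solution_def)
      then have "\<bar>\<phi> 1 j\<bar> \<le> 1" for j
        using M S1 tau[OF nN] Mob V[OF Suc.prems] bd True
        by (intro first_step_bound[where \<phi> = \<phi>]) auto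
      then show ?thesis using True by simp
    next
      case False
      then have "1 \<le> n" by simp
      then have "CN_step M \<epsilon> h Mob S1 S2 t \<phi> n"
        using sol nN by (simp add: DsCN_solution_def)
      then have "\<bar>\<phi> (n + 1) j\<bar> \<le> 1" for j
        using V[OF Suc.prems]
        by (intro CN_step_bound[where \<phi> = \<phi> and n = n, OF M S1 S2 tau[OF nN] Mob
              cond[OF \<open>1 \<le> n\<close> nN] _ bd]) auto
      then show ?thesis by simp
    qed
  qed
  then show ?thesis using sup_norm_h_le_iff_all[OF M V[OF n]] by simp
qed

theorem theorem3p4:
  fixes L \<epsilon> h T S1 S2 K :: real
    and M N :: nat
    and Mob :: "real \<Rightarrow> real"
    and t :: "nat \<Rightarrow> real"
    and \<phi>init :: "real ^ 'd \<Rightarrow> real"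
    and \<phi> :: "nat \<Rightarrow> int ^ 'd \<Rightarrow> real"
  assumes dim: "CARD('d) \<in> {1, 2, 3}"
    and eps: "\<epsilon> > 0"
    and L: "L > 0"
    and M: "M \<ge> 1"
    and h: "h = L / real M"
    and Mob_cont: "continuous_on {-1..1} Mob"
    and Mob_nonneg: "\<And>\<xi>. \<xi> \<in> {-1..1} \<Longrightarrow> Mob \<xi> \<ge> 0"
    and K: "K = K_mob Mob"
    and S1: "S1 \<ge> C_norm (deriv f_AC)"
    and S2: "S2 \<ge> 0"
    and grid: "time_grid T N t"
    and sol: "DsCN_solution M \<epsilon> h Mob S1 S2 N t \<phi>init \<phi>"
  shows "(S2 = 0 \<and>
          (\<forall>n. 1 \<le> n \<and> n < N \<longrightarrow> K \<noteq> 0 \<longrightarrow>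
             tau t (n + 1) \<le> 2 / (S1 * K + 2 * real CARD('d) * K * \<epsilon>\<^sup>2 / h\<^sup>2)) \<longrightarrow>
          sup_norm_h M (\<lambda>i. \<phi>init (grid_point h i)) \<le> 1 \<longrightarrow>
          (\<forall>n\<le>N. sup_norm_h M (\<phi> n) \<le> 1))
       \<and> (S2 \<ge> (S1 * K / 4 + real CARD('d) * \<epsilon>\<^sup>2 * K / (2 * h\<^sup>2))\<^sup>2 \<longrightarrow>
          sup_norm_h M (\<lambda>i. \<phi>init (grid_point h i)) \<le> 1 \<longrightarrow>
          (\<forall>n\<le>N. sup_norm_h M (\<phi> n) \<le> 1))"
proof -
  let ?P = "S1 / 2 + real CARD('d) * \<epsilon>\<^sup>2 / h\<^sup>2"
  have S1': "S1 \<ge> 2" using S1 by (simp add: C_norm_deriv_f_AC)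
  have Mob: "0 \<le> Mob \<xi> \<and> Mob \<xi> \<le> K" if "\<xi> \<in> {-1..1}" for \<xi>
    using Mob_nonneg[OF that] K_mob_max(2)[OF Mob_cont that] K by simp
  have K0: "K \<ge> 0" using Mob[of 0] by simp
  have P: "?P > 0" using S1' by (auto intro!: add_pos_nonneg)
  note bound = DsCN_maximum_bound[OF M S1' S2 grid Mob sol]
  have "sup_norm_h M (\<phi> n) \<le> 1"
    if S2_0: "S2 = 0" and n: "n \<le> N"
      and init: "sup_norm_h M (\<lambda>i. \<phi>init (grid_point h i)) \<le> 1"
      and step: "\<forall>n. 1 \<le> n \<and> n < N \<longrightarrow> K \<noteq> 0 \<longrightarrow>
        tau t (n + 1) \<le> 2 / (S1 * K + 2 * real CARD('d) * K * \<epsilon>\<^sup>2 / h\<^sup>2)" for n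
  proof (rule bound[OF _ _ init n])
    fix n assume n: "1 \<le> n" "n < N"
    show "tau t (n + 1) * K * ?P \<le> 1 + S2 * (tau t (n + 1))\<^sup>2"
    \<comment> \<open>For \<open>K = 0\<close> the quotient in (i) would be \<open>2 / 0 = 0\<close>
      in HOL, hence the guard \<open>K \<noteq> 0\<close>; the condition then reads
      \<open>0 \<le> 1\<close>.\<close>
    proof (cases "K = 0")
      case False
      define Q where "Q = K * ?P"
      have Q: "Q > 0" using False K0 P by (auto simp only: Q_def intro!: mult_pos_pos)
      have "S1 * K + 2 * real CARD('d) * K * \<epsilon>\<^sup>2 / h\<^sup>2 = 2 * Q"
        by (simp add: Q_def algebra_simps)
      then have "tau t (n + 1) \<le> 2 / (2 * Q)" using step n False by metis
      with Q have "tau t (n + 1) * Q \<le> 1" by (simp add: field_simps)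
      then show ?thesis by (simp only: S2_0 Q_def mult.assoc)
    qed (simp add: S2_0)
  qed
  moreover have "sup_norm_h M (\<phi> n) \<le> 1"
    if n: "n \<le> N" and init: "sup_norm_h M (\<lambda>i. \<phi>init (grid_point h i)) \<le> 1"
      and large: "S2 \<ge> (S1 * K / 4 + real CARD('d) * \<epsilon>\<^sup>2 * K / (2 * h\<^sup>2))\<^sup>2" for n
  proof (rule bound[OF _ _ init n])
    fix n
    \<comment> \<open>\<open>?c\<close> is the quantity whose square is the threshold for
      \<open>S2\<close>.\<close>
    let ?\<tau> = "tau t (n + 1)" and ?c = "K * ?P / 2"
    have "S1 * K / 4 + real CARD('d) * \<epsilon>\<^sup>2 * K / (2 * h\<^sup>2) = ?c"
      by (simp add: algebra_simps)
    with large have "?c\<^sup>2 \<le> S2" by (simp only:)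
    then have "?c\<^sup>2 * ?\<tau>\<^sup>2 \<le> S2 * ?\<tau>\<^sup>2" by (intro mult_right_mono) auto
    \<comment> \<open>This holds for every step size; its left side is the left side of the step
      condition, and its square term is absorbed by \<open>S2 * ?\<tau>\<^sup>2\<close>.\<close>
    moreover have "2 * (?c * ?\<tau>) \<le> 1 + (?c * ?\<tau>)\<^sup>2"
      using sum_squares_bound[of 1 "?c * ?\<tau>"] by simp
    moreover have "2 * (?c * ?\<tau>) = ?\<tau> * K * ?P" by simp
    ultimately show "?\<tau> * K * ?P \<le> 1 + S2 * ?\<tau>\<^sup>2"
      unfolding power_mult_distrib by linarith
  qed
  ultimately show ?thesis by blast
qed

end
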